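(* Let $\mathbf{J}$ be the symmetric Jacobi matrix such that $x\,\bar{\mathbf{p}}=\mathbf{J}\,\bar{\mathbf{p}}$, where $\bar{\mathbf{p}}=[p_0(x),p_1(x),p_2(x),\dots]^\intercal$ is the infinite vector associated with the orthonormal polynomial sequence with respect to $d\mu$, and assume $p_n(c)\ne0$ for $n\ge1$. Then there exist an upper triangular semi-infinite matrix $\mathbf{R}$ and an orthogonal semi-infinite matrix $\mathbf{Q}$, i.e. $\mathbf{Q}\mathbf{Q}^\intercal=\mathbf{Q}^\intercal\mathbf{Q}=\mathbf{I}$, such that the factorization $$\mathbf{J}-c\mathbf{I}=\mathbf{Q}\mathbf{R}$$ holds and, moreover, $$\mathbf{R}\mathbf{Q}=\mathbf{J}_{[2]}-c\mathbf{I},$$ where $\mathbf{J}_{[2]}$ is the symmetric Jacobi matrix such that $x\,\bar{\mathbf{p}}^{[2]}=\mathbf{J}_{[2]}\bar{\mathbf{p}}^{[2]}$ and $\bar{\mathbf{p}}^{[2]}=[p_0^{[2]}(x),p_1^{[2]}(x),\dots]^\intercal$ is the infinite vector associated with the orthonormal polynomial sequence with respect to $(x-c)^2d\mu$.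
   Context: $\mu$ is a positive Borel measure with infinite support contained in an interval $E\subseteq\mathbb{R}$ (bounded or unbounded), with all moments finite, and $c\in\mathbb{R}\setminus E$. Orthonormal polynomials are taken of degree $n$ with positive leading coefficients. All matrices are semi-infinite, indexed by $n,k\ge0$; $\mathbf{I}$ is the identity matrix.
   Formalization: QQ^T = I is claimed only when E is bounded or μ is determinate (Hamburger moment problem), since it fails for every indeterminate μ, e.g. log-normal on [0,∞) with c = -1; Q^TQ = I, J - cI = QR and RQ = J_[2] - cI are claimed for all μ. *)

theory Defs
  imports "HOL-Analysis.Analysis" "HOL-Computational_Algebra.Polynomial"
begin

definition measure_support :: "real measure \<Rightarrow> real set" where
  "measure_support M = {x. \<forall>e>0. emeasure M (ball x e) > 0}"

definition finite_moments :: "real measure \<Rightarrow> bool" where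
  "finite_moments M \<longleftrightarrow> (\<forall>n::nat. integrable M (\<lambda>x. x ^ n))"

text \<open>Determinacy in the sense of the Hamburger problem: competing measures may live on all of
  the real line, not just on an interval that carries \<open>M\<close>.\<close>

definition moment_determinate :: "real measure \<Rightarrow> bool" where
  "moment_determinate M \<longleftrightarrow>
     (\<forall>N. sets N = sets borel \<and> finite_moments N \<and>
          (\<forall>n::nat. (\<integral>x. x ^ n \<partial>N) = (\<integral>x. x ^ n \<partial>M)) \<longrightarrow> N = M)"

definition orthonormal_polys :: "real measure \<Rightarrow> (nat \<Rightarrow> real poly) \<Rightarrow> bool" where
  "orthonormal_polys M p \<longleftrightarrow>
     (\<forall>n. degree (p n) = n \<and> lead_coeff (p n) > 0) \<and>
     (\<forall>m n. (\<integral>x. poly (p m) x * poly (p n) x \<partial>M) = (if m = n then 1 else 0))"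

definition christoffel_measure :: "real \<Rightarrow> real measure \<Rightarrow> real measure" where
  "christoffel_measure c M = density M (\<lambda>x. ennreal ((x - c)\<^sup>2))"

type_synonym smat = "nat \<Rightarrow> nat \<Rightarrow> real"

definition smat_id :: smat where
  "smat_id = (\<lambda>i j. if i = j then 1 else 0)"

definition smat_transpose :: "smat \<Rightarrow> smat" where
  "smat_transpose A = (\<lambda>i j. A j i)"

definition smat_shift :: "smat \<Rightarrow> real \<Rightarrow> smat" where
  "smat_shift A c = (\<lambda>i j. A i j - c * smat_id i j)"

text \<open>The product is a relation, so that it includes the convergence of the series which
  define the entries; a function based on \<open>suminf\<close> would give arbitrary values to divergent ones.\<close>

definition has_smat_prod :: "smat \<Rightarrow> smat \<Rightarrow> smat \<Rightarrow> bool" where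
  "has_smat_prod A B C \<longleftrightarrow> (\<forall>i j. (\<lambda>k. A i k * B k j) sums C i j)"

definition orthogonal_smat :: "smat \<Rightarrow> bool" where
  "orthogonal_smat Q \<longleftrightarrow>
     has_smat_prod Q (smat_transpose Q) smat_id \<and> has_smat_prod (smat_transpose Q) Q smat_id"

definition upper_triangular_smat :: "smat \<Rightarrow> bool" where
  "upper_triangular_smat R \<longleftrightarrow> (\<forall>i j. j < i \<longrightarrow> R i j = 0)"

definition symmetric_jacobi :: "smat \<Rightarrow> bool" where
  "symmetric_jacobi J \<longleftrightarrow>
     smat_transpose J = J \<and> (\<forall>i j. Suc i < j \<longrightarrow> J i j = 0) \<and> (\<forall>i. J i (Suc i) > 0)"

text \<open>The symmetric Jacobi matrix \<open>J\<close> with \<open>x p = J p\<close>, where \<open>p\<close> is the column vector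
  of the polynomials. Their degrees make \<open>J\<close> unique.\<close>

definition jacobi_matrix_of :: "(nat \<Rightarrow> real poly) \<Rightarrow> smat \<Rightarrow> bool" where
  "jacobi_matrix_of p J \<longleftrightarrow>
     symmetric_jacobi J \<and> (\<forall>x n. (\<lambda>k. J n k * poly (p k) x) sums (x * poly (p n) x))"

text \<open>For a moment-indeterminate measure the identity \<open>Q Q\<^sup>T = I\<close> is false. As \<open>R\<close> is upper
  triangular, the factorization and \<open>Q\<^sup>T Q = I\<close> determine \<open>Q\<close> up to the signs of its columns:
  column \<open>n\<close> holds the coefficients of \<open>(x - c) p\<^sub>n\<^sup>[\<^sup>2\<^sup>]\<close> in the basis \<open>p\<close>. Hence \<open>Q Q\<^sup>T = I\<close>
  holds iff every \<open>p\<^sub>k\<close> lies in the \<open>L\<^sup>2(\<mu>)\<close>-closure \<open>W\<close> of the polynomials that vanish at \<open>c\<close>,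
  and the distance of \<open>1\<close> from \<open>W\<close> is \<open>(\<Sum>n. p\<^sub>n(c)\<^sup>2) powr (-1/2)\<close>, which is positive for every
  indeterminate \<open>\<mu>\<close>. Example: \<open>\<mu>\<close> log-normal on \<open>[0, \<infinity>)\<close> with \<open>c = -1\<close>, where
  \<open>sin (2 \<pi> ln x) / (x + 1)\<close> is orthogonal to \<open>W\<close> but not to \<open>1\<close>.
  In the statement \<open>Q Q\<^sup>T = I\<close> is therefore claimed for bounded \<open>E\<close> and for determinate \<open>\<mu>\<close>
  (boundedness implies determinacy; it is listed to show that this case is unrestricted),
  and everything else is claimed for all measures.\<close>

end

theory Submission
  imports Defs "HOL-Probability.Probability" "HOL-Computational_Algebra.Fundamental_Theorem_Algebra"
begin

text \<open>Let \<open>L f\<close> be the integral of the polynomial \<open>f\<close>. The polynomials \<open>(x - c) p2 n\<close> are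
  \<open>L\<close>-orthonormal; expanding them in the basis \<open>p\<close> gives \<open>Q\<close>, and expanding \<open>p\<close> in the basis \<open>p2\<close>
  gives \<open>R\<close>. All identities except \<open>Q Q\<^sup>T = I\<close> are then finite instances of Parseval's identity.
  The identity \<open>Q Q\<^sup>T = I\<close> holds once there are polynomials \<open>q\<close> with \<open>q(c) = 1\<close> and \<open>L (q\<^sup>2)\<close>
  arbitrarily small. On a bounded support, powers of a linear polynomial do this. In general, if
  \<open>L (q\<^sup>2) \<ge> \<rho> > 0\<close> for all such \<open>q\<close>, the Gauss--Radau quadrature rules with node \<open>c\<close> give \<open>c\<close> a
  mass of at least \<open>\<rho>\<close>, and by Helly selection they have a weak limit with the moments of \<open>\<mu>\<close> and
  a positive mass at \<open>c\<close>, which contradicts determinacy because \<open>\<mu> {c} = 0\<close>.\<close>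

section \<open>Orthonormal polynomials of a linear functional\<close>

locale poly_functional =
  fixes L :: "real poly \<Rightarrow> real"
  assumes add: "L (f + g) = L f + L g"
    and smult: "L (smult a f) = a * L f"
begin

lemma zero [simp]: "L 0 = 0"
  using smult[of 0 0] by simp

lemma diff: "L (f - g) = L f - L g"
  using add[of f "smult (-1) g"] smult[of "-1" g] by simp

lemma sum: "L (\<Sum>k\<in>S. f k) = (\<Sum>k\<in>S. L (f k))"
  by (induction S rule: infinite_finite_induct) (simp_all add: add)

lemma sum_smult_mult: "L ((\<Sum>k\<in>S. smult (a k) (f k)) * g) = (\<Sum>k\<in>S. a k * L (f k * g))"
  by (simp add: sum_distrib_right sum smult)

end

lemma poly_triangular_basis:
  fixes p :: "nat \<Rightarrow> 'a::field poly"
  assumes "\<And>n. degree (p n) = n" "p 0 \<noteq> 0" "degree f \<le> N"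
  shows "\<exists>a. f = (\<Sum>k\<le>N. smult (a k) (p k))"
  using assms(3)
proof (induction N arbitrary: f)
  case 0
  then obtain b where b: "f = [:b:]"
    using degree_eq_zeroE by blast
  obtain d where d: "p 0 = [:d:]"
    using assms(1)[of 0] degree_eq_zeroE by blast
  with assms(2) b have "f = smult (b / d) (p 0)"
    by simp
  then show ?case
    by (intro exI[of _ "\<lambda>_. b / d"]) simp
next
  case (Suc N)
  define r where "r = coeff f (Suc N) / coeff (p (Suc N)) (Suc N)"
  have "p (Suc N) \<noteq> 0"
    using assms(1)[of "Suc N"] by auto
  then have nz: "coeff (p (Suc N)) (Suc N) \<noteq> 0"
    using assms(1)[of "Suc N"] by (metis leading_coeff_0_iff)
  have "degree (f - smult r (p (Suc N))) \<le> N"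
  proof (rule degree_le, intro allI impI)
    fix i assume "N < i"
    then consider "i = Suc N" | "Suc N < i" by linarith
    then show "coeff (f - smult r (p (Suc N))) i = 0"
    proof cases
      case 1
      then show ?thesis using nz by (simp add: r_def)
    next
      case 2
      then show ?thesis
        using Suc.prems assms(1)[of "Suc N"] by (simp add: coeff_eq_0)
    qed
  qed
  from Suc.IH[OF this] obtain a where a: "f - smult r (p (Suc N)) = (\<Sum>k\<le>N. smult (a k) (p k))"
    by blast
  have "(\<Sum>k\<le>Suc N. smult ((a(Suc N := r)) k) (p k)) = (\<Sum>k\<le>N. smult (a k) (p k)) + smult r (p (Suc N))"
    by simp
  also have "\<dots> = f"
    using a by (simp add: algebra_simps flip: a)
  finally show ?case by metis
qed

locale orthonormal_poly_functional = poly_functional +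
  fixes p :: "nat \<Rightarrow> real poly"
  assumes degree_p [simp]: "degree (p n) = n"
    and orthonormal: "L (p m * p n) = (if m = n then 1 else 0)"
begin

lemma p_nonzero: "p n \<noteq> 0"
  using orthonormal[of n n] by auto

lemma expansion:
  assumes "degree f \<le> N"
  shows "f = (\<Sum>k\<le>N. smult (L (f * p k)) (p k))"
proof -
  obtain a where a: "f = (\<Sum>k\<le>N. smult (a k) (p k))"
    using poly_triangular_basis[of p f N, OF degree_p p_nonzero assms] by blast
  have "L (f * p j) = a j" if "j \<le> N" for j
  proof -
    have "L (f * p j) = (\<Sum>k\<le>N. a k * L (p k * p j))"
      by (subst a) (rule sum_smult_mult)
    also have "\<dots> = (\<Sum>k\<le>N. if k = j then a k else 0)"
      by (intro sum.cong) (auto simp: orthonormal)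
    finally show ?thesis using that by simp
  qed
  then show ?thesis
    by (subst a) (intro sum.cong, auto)
qed

lemma parseval:
  assumes "degree f \<le> N"
  shows "L (f * g) = (\<Sum>k\<le>N. L (f * p k) * L (p k * g))"
  by (subst expansion[OF assms]) (rule sum_smult_mult)

lemma orthogonal_low_degree:
  assumes "degree f < n"
  shows "L (f * p n) = 0"
  using assms by (subst parseval[OF order_refl]) (simp add: orthonormal)

text \<open>Positivity comes from the orthonormal basis: Parseval writes \<open>L (f * f)\<close> as
  a sum of squares.\<close>

lemma square_nonneg: "0 \<le> L (f * f)"
  by (subst parseval[OF order_refl]) (auto intro!: sum_nonneg simp: mult.commute)

lemma square_eq_0_iff: "L (f * f) = 0 \<longleftrightarrow> f = 0"
proof
  assume *: "L (f * f) = 0"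
  have "(\<Sum>k\<le>degree f. (L (f * p k))\<^sup>2) = 0"
    using * by (subst (asm) parseval[OF order_refl]) (simp add: power2_eq_square mult.commute)
  then have "\<And>k. k \<le> degree f \<Longrightarrow> L (f * p k) = 0"
    by (subst (asm) sum_nonneg_eq_0_iff) auto
  then have "(\<Sum>k\<le>degree f. smult (L (f * p k)) (p k)) = 0"
    by (intro sum.neutral) auto
  with expansion[OF order_refl, of f] show "f = 0" by simp
qed simp

lemma cauchy_schwarz: "(L (f * g))\<^sup>2 \<le> L (f * f) * L (g * g)"
proof (cases "g = 0")
  case False
  define b where "b = L (g * g)"
  have b: "0 < b"
    using False square_nonneg[of g] square_eq_0_iff[of g] by (simp add: b_def)
  \<comment> \<open>Up to the factor \<open>b\<close>, \<open>h\<close> is the component of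
    \<open>f\<close> orthogonal to \<open>g\<close>; the scaling avoids division.\<close>
  define h where "h = smult b f - smult (L (f * g)) g"
  have "L (h * h) = b * (b * L (f * f) - (L (f * g))\<^sup>2)"
    unfolding h_def left_diff_distrib right_diff_distrib diff mult_smult_left mult_smult_right smult
    by (simp add: mult.commute[of g f] b_def power2_eq_square algebra_simps)
  with square_nonneg[of h] b show ?thesis
    by (simp add: zero_le_mult_iff b_def mult.commute)
qed simp

text \<open>The band structure of \<open>J\<close> makes the series in the recurrence finite, so it
  is an identity of polynomials, and pairing it with \<open>p j\<close> isolates one entry.\<close>

lemma jacobi_entry:
  assumes "jacobi_matrix_of p J"
  shows "J n j = L ([:0, 1:] * p n * p j)"
proof -
  have zero: "J n k = 0" if "k > Suc n" for k
    using assms that by (auto simp: jacobi_matrix_of_def symmetric_jacobi_def)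
  have "poly (\<Sum>k\<le>Suc n. smult (J n k) (p k)) x = poly ([:0, 1:] * p n) x" for x
  proof -
    have "(\<lambda>k. J n k * poly (p k) x) sums (\<Sum>k\<le>Suc n. J n k * poly (p k) x)"
      by (rule sums_finite) (auto simp: zero)
    moreover have "(\<lambda>k. J n k * poly (p k) x) sums (x * poly (p n) x)"
      using assms by (simp add: jacobi_matrix_of_def)
    ultimately show ?thesis
      using sums_unique2 by (fastforce simp: poly_sum)
  qed
  then have eq: "[:0, 1:] * p n = (\<Sum>k\<le>Suc n. smult (J n k) (p k))"
    by (rule poly_eq_poly_eq_iff[THEN iffD1, OF ext, symmetric])
  have "L ([:0, 1:] * p n * p j) = (\<Sum>k\<le>Suc n. J n k * L (p k * p j))"
    unfolding eq by (rule sum_smult_mult)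
  also have "\<dots> = (\<Sum>k\<le>Suc n. if k = j then J n k else 0)"
    by (intro sum.cong) (auto simp: orthonormal)
  \<comment> \<open>For \<open>j > Suc n\<close> the sum has no term with \<open>k = j\<close>, and
    there \<open>J n j\<close> is 0 as well.\<close>
  also have "\<dots> = J n j"
    using zero[of j] by (auto simp: not_le simp del: sum.atMost_Suc)
  finally show ?thesis ..
qed

end

section \<open>The matrices \<open>Q\<close> and \<open>R\<close> and their products\<close>

locale christoffel_functional = orthonormal_poly_functional L p
  for L :: "real poly \<Rightarrow> real" and p :: "nat \<Rightarrow> real poly" +
  fixes c :: real and p2 :: "nat \<Rightarrow> real poly"
  assumes christoffel: "orthonormal_poly_functional (\<lambda>f. L ([:-c, 1:] * ([:-c, 1:] * f))) p2"
begin

text \<open>If \<open>L\<close> is integration against \<mu>, the modified functional belongs to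
  \<open>(x - c)\<^sup>2 d\<mu>\<close>. As a second instance of the locale it supplies expansions
  and Jacobi entries for \<open>p2\<close> too.\<close>

sublocale C: orthonormal_poly_functional "\<lambda>f. L ([:-c, 1:] * ([:-c, 1:] * f))" p2
  by (rule christoffel)

definition X :: "real poly" where "X = [:-c, 1:]"

text \<open>Column \<open>j\<close> of \<open>R\<close> lists the coefficients of \<open>p j\<close> in the basis \<open>p2\<close>.\<close>

definition Q :: smat where "Q i n = L (p i * (X * p2 n))"

definition R :: smat where "R n j = L (X * p2 n * (X * p j))"

lemma functional_X_mult: "L (X * f) = L ([:0, 1:] * f) - c * L f"
proof -
  have "X * f = [:0, 1:] * f - smult c f"
    by (simp add: X_def)
  then show ?thesis
    by (simp only: diff smult)
qed

lemma degree_X_mult: "degree (X * p2 n) \<le> Suc n"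
  using degree_mult_le[of X "p2 n"] by (simp add: X_def)

lemma C_alt: "L ([:-c, 1:] * ([:-c, 1:] * (f * g))) = L (X * f * (X * g))"
  by (simp add: X_def algebra_simps)

lemma orthonormal_X: "L (X * p2 m * (X * p2 n)) = (if m = n then 1 else 0)"
  using C.orthonormal[of m n] by (simp only: C_alt)

text \<open>\<open>X * p2 n\<close> has degree at most \<open>Suc n\<close>, so it is orthogonal to
  \<open>p i\<close> for larger \<open>i\<close>. Hence \<open>Q\<close> is upper Hessenberg and
  sums along its columns are finite.\<close>

lemma Q_eq_0:
  assumes "Suc n < i"
  shows "Q i n = 0"
  using orthogonal_low_degree[of "X * p2 n" i] degree_X_mult[of n] assms
  by (simp add: Q_def mult.commute)

text \<open>By \<open>C_alt\<close>, \<open>R n j\<close> is the inner product of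
  \<open>p2 n\<close> and \<open>p j\<close> for the modified functional, where \<open>p2 n\<close>
  is orthogonal to all lower degrees.\<close>

lemma R_eq_0:
  assumes "j < n"
  shows "R n j = 0"
  using C.orthogonal_low_degree[of "p j" n] assms
  by (simp only: C_alt R_def degree_p C.degree_p) (simp add: mult_ac)

lemma upper_triangular_R: "upper_triangular_smat R"
  by (simp add: upper_triangular_smat_def R_eq_0)

lemma Qt_Q: "has_smat_prod (smat_transpose Q) Q smat_id"
  unfolding has_smat_prod_def smat_transpose_def
proof (intro allI)
  fix i j
  have "(\<lambda>k. Q k i * Q k j) sums (\<Sum>k\<le>Suc i. Q k i * Q k j)"
    by (rule sums_finite) (auto simp: Q_eq_0)
  also have "(\<Sum>k\<le>Suc i. Q k i * Q k j) = L (X * p2 i * (X * p2 j))"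
    by (subst parseval[OF degree_X_mult]) (simp add: Q_def mult_ac del: sum.atMost_Suc)
  finally show "(\<lambda>k. Q k i * Q k j) sums smat_id i j"
    by (simp add: orthonormal_X smat_id_def)
qed

lemma Q_R:
  assumes "jacobi_matrix_of p J"
  shows "has_smat_prod Q R (smat_shift J c)"
  unfolding has_smat_prod_def
proof (intro allI)
  fix i j
  have "(\<lambda>k. Q i k * R k j) sums (\<Sum>k\<le>j. Q i k * R k j)"
    by (rule sums_finite) (auto simp: R_eq_0)
  also have "(\<Sum>k\<le>j. Q i k * R k j) = (\<Sum>k\<le>j. L (X * p j * (X * p2 k)) * L (p2 k * (X * p i)))"
    by (simp add: Q_def R_def mult_ac)
  \<comment> \<open>The factors \<open>L (X * p j * (X * p2 k))\<close> are the coefficients of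
    \<open>p j\<close> in the basis \<open>p2\<close>, so the sum is its expansion tested against
    \<open>X * p i\<close>.\<close>
  also have "\<dots> = L (p j * (X * p i))"
    using C.expansion[of "p j" j] sum_smult_mult[of _ p2 _ "X * p i"]
    unfolding C_alt by (metis degree_p order_refl)
  also have "\<dots> = L ([:0, 1:] * p i * p j) - c * L (p i * p j)"
    using functional_X_mult[of "p i * p j"] by (simp only: mult_ac)
  also have "\<dots> = smat_shift J c i j"
    by (simp add: jacobi_entry[OF assms] orthonormal smat_shift_def smat_id_def)
  finally show "(\<lambda>k. Q i k * R k j) sums smat_shift J c i j" .
qed

lemma R_Q:
  assumes "jacobi_matrix_of p2 J2"
  shows "has_smat_prod R Q (smat_shift J2 c)"
  unfolding has_smat_prod_def
proof (intro allI)
  fix i j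
  have "(\<lambda>k. R i k * Q k j) sums (\<Sum>k\<le>Suc j. R i k * Q k j)"
    by (rule sums_finite) (auto simp: Q_eq_0)
  \<comment> \<open>Parseval in the basis \<open>p\<close>, for \<open>X * p2 j\<close> against
    \<open>X * (X * p2 i)\<close>; in the product \<open>Q R\<close> the inner index belongs to
    \<open>p2\<close> instead.\<close>
  also have "(\<Sum>k\<le>Suc j. R i k * Q k j) = L (X * p2 j * (X * (X * p2 i)))"
    by (subst parseval[OF degree_X_mult]) (simp add: Q_def R_def mult_ac del: sum.atMost_Suc)
  also have "\<dots> = L (X * ([:0, 1:] * p2 i) * (X * p2 j)) - c * L (X * p2 i * (X * p2 j))"
    using functional_X_mult[of "X * p2 i * (X * p2 j)"] by (simp only: mult_ac)
  also have "\<dots> = smat_shift J2 c i j"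
    using C.jacobi_entry[OF assms, of i j] unfolding C_alt
    by (simp add: orthonormal_X smat_shift_def smat_id_def)
  finally show "(\<lambda>k. R i k * Q k j) sums smat_shift J2 c i j" .
qed

text \<open>Row \<open>i\<close> of \<open>Q\<close> lists the coefficients of \<open>p i\<close> in
  the orthonormal system \<open>X * p2 n\<close>, so \<open>Q Q\<^sup>T = I\<close> says that the
  span of this system approximates every \<open>p i\<close>. The span consists of all polynomials
  that vanish at \<open>c\<close>, and \<open>p i\<close> differs from one of these by a multiple of
  \<open>q\<close>.\<close>

lemma orthogonal_Q:
  assumes small: "\<And>\<epsilon>. 0 < \<epsilon> \<Longrightarrow> \<exists>q. poly q c = 1 \<and> L (q * q) < \<epsilon>"
  shows "orthogonal_smat Q"
proof -
  \<comment> \<open>\<open>e N i\<close> is the residual of the orthogonal projection of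
    \<open>p i\<close> on the first \<open>N\<close> members of the system.\<close>
  define e where "e N i = p i - (\<Sum>n<N. smult (Q i n) (X * p2 n))" for N i
  have Q_sum: "L ((\<Sum>n<N. smult (Q i n) (X * p2 n)) * g) = (\<Sum>n<N. Q i n * L (X * p2 n * g))" for N i g
    by (rule sum_smult_mult)
  have e_orth: "L (e N i * (X * p2 m)) = 0" if "m < N" for N i m
  proof -
    have "(\<Sum>n<N. Q i n * L (X * p2 n * (X * p2 m))) = (\<Sum>n<N. if n = m then Q i n else 0)"
      by (intro sum.cong) (auto simp: orthonormal_X)
    with that show ?thesis
      by (simp add: e_def left_diff_distrib diff Q_sum) (simp add: Q_def)
  qed
  have e_orth': "L (e N i * (X * s)) = 0" if "degree s < N" for N i s
  proof -
    have "L (s * (X * e N i)) = (\<Sum>k\<le>degree s. L (X * s * (X * p2 k)) * L (p2 k * (X * e N i)))"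
      using C.expansion[of s "degree s"] sum_smult_mult[of _ p2 _ "X * e N i"]
      unfolding C_alt by (metis order_refl)
    also have "\<dots> = 0"
      using that e_orth by (intro sum.neutral) (auto simp: mult_ac)
    finally show ?thesis by (simp add: mult_ac)
  qed
  \<comment> \<open>The inner products of residuals are exactly the errors of the partial sums of
    \<open>Q Q\<^sup>T\<close>, so it remains to send them to 0.\<close>
  have ee: "L (e N i * e N j) = smat_id i j - (\<Sum>n<N. Q i n * Q j n)" for N i j
  proof -
    have "L (e N i * (\<Sum>n<N. smult (Q j n) (X * p2 n))) = (\<Sum>n<N. Q j n * L (X * p2 n * e N i))"
      by (subst mult.commute) (rule sum_smult_mult)
    also have "\<dots> = 0"
      using e_orth by (intro sum.neutral) (auto simp: mult_ac)
    finally have "L (e N i * e N j) = L (e N i * p j)"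
      by (simp add: e_def[of N j] right_diff_distrib diff)
    also have "\<dots> = smat_id i j - (\<Sum>n<N. Q i n * Q j n)"
      by (simp add: e_def left_diff_distrib diff Q_sum orthonormal smat_id_def) (simp add: Q_def mult_ac)
    finally show ?thesis .
  qed
  \<comment> \<open>Pythagoras: \<open>e N i\<close> is orthogonal to all \<open>X * s\<close> with
    \<open>degree s < N\<close>, so the projection is the best approximation by such
    products.\<close>
  have best: "L (e N i * e N i) \<le> L ((p i - X * s) * (p i - X * s))" if "degree s < N" for N i s
  proof -
    define h where "h = (\<Sum>n<N. smult (Q i n) (X * p2 n)) - X * s"
    have "L (e N i * (\<Sum>n<N. smult (Q i n) (X * p2 n))) = (\<Sum>n<N. Q i n * L (X * p2 n * e N i))"
      by (subst mult.commute) (rule sum_smult_mult)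
    also have "\<dots> = 0"
      using e_orth by (intro sum.neutral) (auto simp: mult_ac)
    finally have eh: "L (e N i * h) = 0"
      using e_orth'[OF that] by (simp add: h_def right_diff_distrib diff)
    have "p i - X * s = e N i + h"
      by (simp add: e_def h_def)
    then have "L ((p i - X * s) * (p i - X * s)) = L ((e N i + h) * (e N i + h))"
      by simp
    also have "\<dots> = L (e N i * e N i) + L (e N i * h) + (L (e N i * h) + L (h * h))"
      unfolding distrib_left distrib_right add by (simp only: mult.commute[of h "e N i"])
    finally have "L ((p i - X * s) * (p i - X * s)) = L (e N i * e N i) + L (h * h)"
      using eh by simp
    with square_nonneg[of h] show ?thesis by simp
  qed
  have lim: "(\<lambda>N. L (e N i * e N i)) \<longlonglongrightarrow> 0" for i
  proof (rule LIMSEQ_I)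
    fix r :: real assume "0 < r"
    \<comment> \<open>Adding 1 keeps \<open>d\<close> positive even if \<open>p i\<close> vanishes
      at \<open>c\<close>.\<close>
    define d where "d = (poly (p i) c)\<^sup>2 + 1"
    have "0 < d" by (simp add: d_def add_nonneg_pos)
    with \<open>0 < r\<close> obtain q where q: "poly q c = 1" "L (q * q) < r / d"
      using small[of "r / d"] by auto
    have "poly (p i - smult (poly (p i) c) q) c = 0"
      by (simp add: q)
    then obtain s where s: "p i - smult (poly (p i) c) q = X * s"
      unfolding poly_eq_0_iff_dvd X_def dvd_def by blast
    then have s': "p i - X * s = smult (poly (p i) c) q"
      by (simp add: algebra_simps flip: s)
    have "norm (L (e N i * e N i) - 0) < r" if "N \<ge> Suc (degree s)" for N
    proof -
      have "L (e N i * e N i) \<le> (poly (p i) c)\<^sup>2 * L (q * q)"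
        using best[of s N i] that unfolding s' by (simp add: smult power2_eq_square mult_ac)
      also have "\<dots> \<le> d * L (q * q)"
        by (intro mult_right_mono square_nonneg) (simp add: d_def)
      also have "\<dots> < r"
        using q \<open>0 < d\<close> by (simp add: field_simps)
      finally show ?thesis
        using square_nonneg[of "e N i"] by simp
    qed
    then show "\<exists>N0. \<forall>N\<ge>N0. norm (L (e N i * e N i) - 0) < r" by blast
  qed
  \<comment> \<open>Cauchy-Schwarz reduces the mixed products to the norms just treated.\<close>
  have lim': "(\<lambda>N. L (e N i * e N j)) \<longlonglongrightarrow> 0" for i j
  proof -
    have "(\<lambda>N. L (e N i * e N i) * L (e N j * e N j)) \<longlonglongrightarrow> 0"
      using tendsto_mult[OF lim[of i] lim[of j]] by simp
    then have "(\<lambda>N. (L (e N i * e N j))\<^sup>2) \<longlonglongrightarrow> 0"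
      by (rule Lim_null_comparison[rotated]) (auto intro!: always_eventually cauchy_schwarz)
    from tendsto_real_sqrt[OF this] show ?thesis
      by (simp add: tendsto_rabs_zero_iff)
  qed
  have "(\<lambda>n. Q i n * Q j n) sums smat_id i j" for i j
    using tendsto_diff[OF tendsto_const[of "smat_id i j"] lim'[of i j]]
    by (simp add: ee sums_def)
  with Qt_Q show ?thesis
    by (simp add: orthogonal_smat_def has_smat_prod_def smat_transpose_def)
qed

end

section \<open>Gauss--Radau quadrature\<close>

lemma map_poly_of_real_add:
  "map_poly of_real (f + g) = (map_poly of_real f + map_poly of_real g :: 'a::real_algebra_1 poly)"
  by (intro poly_eqI) (simp add: coeff_map_poly)

lemma map_poly_of_real_mult:
  "map_poly of_real (f * g) = (map_poly of_real f * map_poly of_real g :: 'a::{real_algebra_1, comm_ring_1} poly)"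
  by (intro poly_eqI) (simp add: coeff_map_poly coeff_mult)

lemma poly_map_poly_of_real:
  "poly (map_poly of_real f) (of_real x) = (of_real (poly f x) :: 'a::{real_algebra_1, comm_ring_1})"
  by (induction f) (simp_all add: map_poly_pCons)

text \<open>The quadratic is \<open>(x - a)\<^sup>2 + b\<^sup>2\<close>, with the conjugate roots
  \<open>a + i b\<close> and \<open>a - i b\<close>. The remainder of \<open>f\<close> modulo it is
  real, of degree at most 1 and zero at a non-real point, hence 0.\<close>

lemma real_quadratic_dvd:
  fixes f :: "real poly"
  assumes "poly (map_poly complex_of_real f) (Complex a b) = 0" "b \<noteq> 0"
  shows "[:a\<^sup>2 + b\<^sup>2, -2 * a, 1:] dvd f"
proof -
  define t where "t = [:a\<^sup>2 + b\<^sup>2, -2 * a, 1:]"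
  define r where "r = f mod t"
  have "t \<noteq> 0" "degree t = 2" by (auto simp: t_def)
  then have "degree r < 2"
    using degree_mod_less[of t f] by (auto simp: r_def)
  then have r: "r = [:coeff r 0, coeff r 1:]"
    by (intro poly_eqI) (auto simp: coeff_pCons coeff_eq_0 split: nat.split)
  have "f = t * (f div t) + r" by (simp add: r_def)
  then have "map_poly complex_of_real f = map_poly of_real t * map_poly of_real (f div t) + map_poly of_real r"
    by (metis map_poly_of_real_add map_poly_of_real_mult)
  moreover have "poly (map_poly complex_of_real t) (Complex a b) = 0"
    by (simp add: t_def map_poly_pCons complex_eq_iff power2_eq_square algebra_simps)
  ultimately have "poly (map_poly complex_of_real r) (Complex a b) = 0"
    using assms by simp
  then have "poly (map_poly complex_of_real [:coeff r 0, coeff r 1:]) (Complex a b) = 0"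
    unfolding r[symmetric] .
  then have "coeff r 1 * b = 0" "coeff r 0 + coeff r 1 * a = 0"
    by (simp_all add: map_poly_pCons complex_eq_iff mult.commute)
  with assms(2) have "coeff r 0 = 0" "coeff r 1 = 0"
    by auto
  then have "r = 0"
    using r by (metis pCons_0_0)
  then show ?thesis
    by (simp add: r_def t_def mod_eq_0_iff_dvd)
qed

text \<open>The excluded divisors are \<open>(x - a)\<^sup>2 + b\<^sup>2\<close>: those with
  \<open>b \<noteq> 0\<close> rule out non-real roots, those with \<open>b = 0\<close> multiple
  ones. In the quadrature both cases appear as one nonnegative factor.\<close>

lemma card_real_roots_eq_degree:
  fixes f :: "real poly"
  assumes "f \<noteq> 0" "\<And>a b. \<not> [:a\<^sup>2 + b\<^sup>2, -2 * a, 1:] dvd f"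
  shows "card {x. poly f x = 0} = degree f"
  using assms
proof (induction "degree f" arbitrary: f)
  case 0
  then obtain d where "f = [:d:]" "d \<noteq> 0"
    by (metis degree_eq_zeroE pCons_0_0)
  then show ?case by simp
next
  case (Suc n)
  have "degree (map_poly complex_of_real f) = degree f"
    by (rule degree_map_poly) auto
  then have "\<not> constant (poly (map_poly complex_of_real f))"
    using Suc.hyps(2) by (simp add: constant_degree)
  then obtain z where z: "poly (map_poly complex_of_real f) z = 0"
    using fundamental_theorem_of_algebra by blast
  then have "Im z = 0"
    using real_quadratic_dvd[of f "Re z" "Im z"] Suc.prems(2) by auto
  then have "z = of_real (Re z)"
    by (simp add: complex_eq_iff)
  with z have "poly f (Re z) = 0"
    by (metis of_real_eq_0_iff poly_map_poly_of_real)
  then obtain g where g: "f = [:- Re z, 1:] * g"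
    by (auto simp only: poly_eq_0_iff_dvd dvd_def)
  define a where "a = Re z"
  have "g \<noteq> 0" using g Suc.prems(1) by auto
  have "poly g a \<noteq> 0"
  proof
    assume "poly g a = 0"
    then obtain h where "g = [:- a, 1:] * h"
      by (auto simp only: poly_eq_0_iff_dvd dvd_def)
    with g have "f = ([:- a, 1:] * [:- a, 1:]) * h"
      unfolding a_def by (simp only: mult.assoc)
    also have "[:- a, 1:] * [:- a, 1:] = [:a\<^sup>2 + 0\<^sup>2, -2 * a, 1:]"
      by (simp add: power2_eq_square)
    finally have "f = [:a\<^sup>2 + 0\<^sup>2, -2 * a, 1:] * h" .
    with Suc.prems(2)[of a 0] show False
      by (metis dvd_triv_left)
  qed
  have deg: "degree f = Suc (degree g)"
    unfolding g using \<open>g \<noteq> 0\<close> by (subst degree_mult_eq) auto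
  have "card {x. poly g x = 0} = degree g"
    using Suc.hyps(1)[of g] Suc.hyps(2) Suc.prems(2) deg \<open>g \<noteq> 0\<close>
    unfolding g by (metis Suc_inject dvd_mult)
  moreover have "{x. poly f x = 0} = insert a {x. poly g x = 0}"
    unfolding g a_def[symmetric] by auto
  ultimately show ?case
    using \<open>poly g a \<noteq> 0\<close> poly_roots_finite[OF \<open>g \<noteq> 0\<close>] by (simp add: deg)
qed

lemma lagrange_basis:
  fixes T :: "'a::field set"
  assumes "finite T" "card T = Suc n"
  obtains l where "\<And>t. t \<in> T \<Longrightarrow> degree (l t) \<le> n"
    and "\<And>t s. t \<in> T \<Longrightarrow> s \<in> T \<Longrightarrow> poly (l t) s = (if s = t then 1 else 0)"
    and "\<And>h. degree h \<le> n \<Longrightarrow> h = (\<Sum>t\<in>T. smult (poly h t) (l t))"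
proof
  define l where "l t = smult (1 / (\<Prod>s\<in>T - {t}. t - s)) (\<Prod>s\<in>T - {t}. [:- s, 1:])" for t
  show deg: "degree (l t) \<le> n" if "t \<in> T" for t
  proof -
    have "degree (\<Prod>s\<in>T - {t}. [:- s, 1:]) \<le> (\<Sum>s\<in>T - {t}. 1)"
      using assms(1) by (intro order.trans[OF degree_prod_sum_le] sum_mono) auto
    with assms that show ?thesis
      by (auto simp: l_def intro: order.trans[OF degree_smult_le])
  qed
  show val: "poly (l t) s = (if s = t then 1 else 0)" if "t \<in> T" "s \<in> T" for t s
  proof -
    have "(\<Prod>r\<in>T - {t}. t - r) \<noteq> 0"
      using assms(1) by simp
    moreover have "(\<Prod>r\<in>T - {t}. s - r) = 0" if "s \<noteq> t"
      using that assms(1) \<open>s \<in> T\<close> by (intro prod_zero) auto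
    ultimately show ?thesis
      by (simp add: l_def poly_prod)
  qed
  show "h = (\<Sum>t\<in>T. smult (poly h t) (l t))" if "degree h \<le> n" for h
  proof (rule poly_eqI_degree)
    show "poly h x = poly (\<Sum>t\<in>T. smult (poly h t) (l t)) x" if "x \<in> T" for x
    proof -
      have "(\<Sum>t\<in>T. poly h t * poly (l t) x) = (\<Sum>t\<in>T. if t = x then poly h t else 0)"
        using that by (intro sum.cong) (auto simp: val)
      with that assms(1) show ?thesis
        by (simp add: poly_sum)
    qed
    have "degree (\<Sum>t\<in>T. smult (poly h t) (l t)) \<le> n"
      using deg assms(1) by (intro degree_sum_le) (auto intro: order.trans[OF degree_smult_le])
    then show "degree (\<Sum>t\<in>T. smult (poly h t) (l t)) < card T" "degree h < card T"
      using assms(2) that by auto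
  qed
qed

section \<open>Reproducing kernel and the quadrature rule\<close>

context orthonormal_poly_functional
begin

text \<open>The Christoffel--Darboux kernel with one argument fixed at \<open>c\<close>.\<close>

definition kernel :: "real \<Rightarrow> nat \<Rightarrow> real poly" where
  "kernel c n = (\<Sum>k\<le>n. smult (poly (p k) c) (p k))"

lemma degree_kernel_le: "degree (kernel c n) \<le> n"
  unfolding kernel_def by (intro degree_sum_le) (auto intro: order.trans[OF degree_smult_le])

lemma kernel_reproducing:
  assumes "degree f \<le> n"
  shows "L (kernel c n * f) = poly f c"
proof -
  have "poly f c = poly (\<Sum>k\<le>n. smult (L (f * p k)) (p k)) c"
    by (subst expansion[OF assms]) (rule refl)
  also have "\<dots> = (\<Sum>k\<le>n. poly (p k) c * L (p k * f))"
    by (simp add: poly_sum mult_ac)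
  finally show ?thesis
    unfolding kernel_def by (simp only: sum_smult_mult)
qed

text \<open>Only the term \<open>k = n\<close> reaches degree \<open>n\<close>, and its factor
  \<open>poly (p n) c\<close> is nonzero.\<close>

lemma degree_kernel:
  assumes "poly (p n) c \<noteq> 0"
  shows "degree (kernel c n) = n"
proof (rule antisym[OF degree_kernel_le le_degree])
  have "coeff (kernel c n) n = (\<Sum>k\<le>n. poly (p k) c * coeff (p k) n)"
    by (simp add: kernel_def coeff_sum)
  also have "\<dots> = (\<Sum>k\<le>n. if k = n then poly (p n) c * coeff (p n) n else 0)"
    by (intro sum.cong) (auto simp: coeff_eq_0)
  finally show "coeff (kernel c n) n \<noteq> 0"
    using assms p_nonzero[of n] by (simp flip: leading_coeff_0_iff)
qed

lemma poly_kernel_pos: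
  assumes "poly (p n) c \<noteq> 0"
  shows "0 < poly (kernel c n) c"
  using assms by (auto simp: kernel_def poly_sum power2_eq_square[symmetric] intro: sum_pos2[of _ n])

text \<open>Gauss--Radau quadrature with the prescribed node \<open>c\<close>. The other nodes are the zeros of the
  kernel polynomial, which is orthogonal with respect to \<open>(x - c) d\<mu>\<close>; \<open>\<sigma>\<close> is the sign that makes
  this measure positive.\<close>

lemma gauss_radau:
  assumes nz: "poly (p n) c \<noteq> 0"
    and pos: "\<And>f. f \<noteq> 0 \<Longrightarrow> (\<And>x. 0 \<le> poly f x) \<Longrightarrow> 0 < \<sigma> * L ([:-c, 1:] * f)"
  obtains T w q where "finite T" "c \<in> T" "\<And>t. t \<in> T \<Longrightarrow> 0 \<le> w t"
    "poly q c = 1" "w c = L (q * q)"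
    "\<And>f. degree f \<le> 2 * n \<Longrightarrow> L f = (\<Sum>t\<in>T. w t * poly f t)"
proof -
  define K where "K = kernel c n"
  define P where "P = [:-c, 1:] * K"
  have K: "degree K = n" "poly K c > 0" "K \<noteq> 0"
    using degree_kernel[OF nz] poly_kernel_pos[OF nz] by (auto simp: K_def)
  have P_orth: "L (P * g) = 0" if "degree g < n" for g
  proof -
    \<comment> \<open>The kernel reproduces the value at \<open>c\<close>, and
      \<open>(x - c) g\<close> vanishes there.\<close>
    have "degree ([:-c, 1:] * g) \<le> n"
      using degree_mult_le[of "[:-c, 1:]" g] that by simp
    then have "L (K * ([:-c, 1:] * g)) = 0"
      by (simp only: K_def kernel_reproducing) simp
    then show ?thesis by (simp only: P_def mult_ac)
  qed
  have "card {x. poly K x = 0} = degree K"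
  proof (rule card_real_roots_eq_degree[OF \<open>K \<noteq> 0\<close>])
    fix a b :: real
    define t where "t = [:a\<^sup>2 + b\<^sup>2, -2 * a, 1:]"
    show "\<not> [:a\<^sup>2 + b\<^sup>2, -2 * a, 1:] dvd K"
    proof
      \<comment> \<open>If \<open>K = t u\<close>, then \<open>P u = (x - c) t u\<^sup>2\<close>: by
        \<open>pos\<close> the functional is nonzero on it, while the orthogonality of
        \<open>P\<close> to degrees below \<open>n\<close> makes it 0.\<close>
      assume "[:a\<^sup>2 + b\<^sup>2, -2 * a, 1:] dvd K"
      then obtain u where u: "K = t * u" by (auto simp: dvd_def t_def)
      have "t \<noteq> 0" "degree t = 2" by (auto simp: t_def)
      with u K have "u \<noteq> 0" by auto
      then have "degree u < n"
        using K(1) \<open>t \<noteq> 0\<close> \<open>degree t = 2\<close> unfolding u by (simp add: degree_mult_eq)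
      have "poly t x = (x - a)\<^sup>2 + b\<^sup>2" for x
        by (simp add: t_def power2_eq_square algebra_simps)
      then have "0 \<le> poly (t * (u * u)) x" for x
        by (simp add: flip: power2_eq_square)
      then have "0 < \<sigma> * L ([:-c, 1:] * (t * (u * u)))"
        using \<open>t \<noteq> 0\<close> \<open>u \<noteq> 0\<close> by (intro pos) auto
      moreover have "L ([:-c, 1:] * (t * (u * u))) = L (P * u)"
        by (simp only: P_def u mult_ac)
      ultimately show False
        using P_orth[OF \<open>degree u < n\<close>] by simp
    qed
  qed
  define T where "T = insert c {x. poly K x = 0}"
  \<comment> \<open>\<open>poly K c > 0\<close> keeps \<open>c\<close> apart from the
    \<open>n\<close> roots of \<open>K\<close>, so there are \<open>n + 1\<close> nodes.\<close>
  have T: "finite T" "c \<in> T" "card T = Suc n"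
    using K poly_roots_finite[OF \<open>K \<noteq> 0\<close>] \<open>card _ = degree K\<close> by (auto simp: T_def)
  have "degree P = degree [:-c, 1:] + degree K"
    unfolding P_def using \<open>K \<noteq> 0\<close> by (intro degree_mult_eq) auto
  with K have P: "degree P = Suc n" "P \<noteq> 0"
    by auto
  obtain l where l_deg: "\<And>t. t \<in> T \<Longrightarrow> degree (l t) \<le> n"
    and l_val: "\<And>t s. t \<in> T \<Longrightarrow> s \<in> T \<Longrightarrow> poly (l t) s = (if s = t then 1 else 0)"
    and l_sum: "\<And>h. degree h \<le> n \<Longrightarrow> h = (\<Sum>t\<in>T. smult (poly h t) (l t))"
    using lagrange_basis[OF T(1,3)] by blast
  \<comment> \<open>Divide by the nodal polynomial \<open>P\<close> of degree \<open>n + 1\<close>: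
    the quotient is 0 or has degree below \<open>n\<close>, so \<open>L\<close> annihilates
    \<open>P\<close> times it, and the remainder is interpolated exactly.\<close>
  have exact: "L f = (\<Sum>t\<in>T. L (l t) * poly f t)" if "degree f \<le> 2 * n" for f
  proof -
    have mod: "degree (f mod P) \<le> n"
      using degree_mod_less[of P f] P by auto
    have f: "f = P * (f div P) + f mod P" by simp
    have "L (P * (f div P)) = 0"
    proof (cases "f div P = 0")
      case False
      then have "degree (P * (f div P)) = Suc n + degree (f div P)"
        using P by (simp add: degree_mult_eq)
      moreover from this have "degree f = degree (P * (f div P))"
        using mod by (subst f, intro degree_add_eq_left) simp
      ultimately show ?thesis
        using that by (intro P_orth) simp
    qed simp
    then have "L f = L (f mod P)"
      by (subst f, simp only: add)
    also have "\<dots> = (\<Sum>t\<in>T. L (l t) * poly (f mod P) t)"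
      by (subst l_sum[OF mod]) (simp add: sum smult mult.commute)
    also have "\<dots> = (\<Sum>t\<in>T. L (l t) * poly f t)"
    proof (intro sum.cong refl)
      fix t assume "t \<in> T"
      then have "poly P t = 0" by (auto simp: T_def P_def)
      then have "poly f t = poly (f mod P) t"
        by (subst f, simp only: poly_add poly_mult)
      then show "L (l t) * poly (f mod P) t = L (l t) * poly f t" by simp
    qed
    finally show ?thesis .
  qed
  \<comment> \<open>The square of \<open>l t\<close> has degree at most \<open>2 * n\<close> and
    equals \<open>l t\<close> at the nodes, so the weight is \<open>L\<close> of a square. For the
    node \<open>c\<close>, \<open>l c\<close> serves as \<open>q\<close>.\<close>
  have weight: "L (l t) = L (l t * l t)" if "t \<in> T" for t
  proof -
    have "degree (l t * l t) \<le> 2 * n"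
      using degree_mult_le[of "l t" "l t"] l_deg[OF that] by linarith
    from exact[OF this] have "L (l t * l t) = (\<Sum>s\<in>T. if s = t then L (l s) else 0)"
      using that by (auto simp: l_val intro!: sum.cong)
    with that T show ?thesis by simp
  qed
  show ?thesis
    using T square_nonneg weight l_val exact
    by (intro that[of T "\<lambda>t. L (l t)" "l c"]) auto
qed

end

section \<open>Limits of moment sequences\<close>

text \<open>The complement of the support is a union of open null balls, and by the Lindelof
  property countably many of them suffice.\<close>

lemma AE_measure_support:
  assumes "sets M = sets borel"
  shows "AE x in M. x \<in> measure_support M"
proof -
  define F where "F = {U. \<exists>x e. U = ball x e \<and> emeasure M (ball x e) = 0}"
  obtain F' where F': "F' \<subseteq> F" "countable F'" "\<Union>F' = \<Union>F"
    by (rule Lindelof[of F]) (auto simp: F_def)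
  have "(\<Union>U\<in>F'. U) \<in> null_sets M"
    using F' by (intro null_sets_UN') (auto simp: F_def null_sets_def assms)
  then have "\<Union>F \<in> null_sets M"
    using F' by simp
  moreover have "{x \<in> space M. x \<notin> measure_support M} \<subseteq> \<Union>F"
    by (force simp: measure_support_def F_def not_less intro: centre_in_ball[THEN iffD2])
  ultimately show ?thesis
    by (rule AE_I')
qed

lemma integrable_poly:
  assumes "finite_moments M"
  shows "integrable M (poly f)"
  using assms unfolding poly_altdef[abs_def] finite_moments_def by simp

lemma poly_functional_integral:
  assumes "finite_moments M"
  shows "poly_functional (\<lambda>f. \<integral>x. poly f x \<partial>M)"
  by standard (simp_all add: integrable_poly[OF assms] integrable_poly[OF assms, unfolded poly_altdef])

text \<open>Clipping makes \<open>x ^ k\<close> bounded and continuous, as weak convergence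
  requires. The error lives where \<open>\<bar>x\<bar> > r\<close>, and there
  \<open>\<bar>x\<bar> ^ k \<le> x ^ (2 * k + 2) / r\<close>; the even exponent gives a moment
  without absolute values.\<close>

lemma (in real_distribution) truncated_moment_error:
  assumes "integrable M (\<lambda>x. x ^ k)" "integrable M (\<lambda>x. x ^ (2 * k + 2))"
    and "(\<integral>x. x ^ (2 * k + 2) \<partial>M) \<le> B" "1 \<le> r"
  shows "\<bar>(\<integral>x. x ^ k \<partial>M) - (\<integral>x. (max (- r) (min r x)) ^ k \<partial>M)\<bar> \<le> 2 * B / r"
proof -
  define g where "g x = (max (- r) (min r x)) ^ k" for x
  have [measurable]: "g \<in> borel_measurable M"
    by (simp add: g_def[abs_def])
  have bound: "\<bar>max (- r) (min r x)\<bar> \<le> r" "\<bar>max (- r) (min r x)\<bar> \<le> \<bar>x\<bar>" for x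
    using assms(4) by linarith+
  have int_g: "integrable M g"
    by (rule integrable_const_bound[of _ "r ^ k"])
       (auto simp: g_def power_abs intro!: AE_I2 power_mono bound)
  have error: "\<bar>x ^ k - g x\<bar> \<le> 2 * x ^ (2 * k + 2) / r" for x
  proof (cases "\<bar>x\<bar> \<le> r")
    case True
    then have "g x = x ^ k" by (auto simp: g_def abs_le_iff max_def min_def)
    with assms(4) zero_le_even_power[of "2 * k + 2" x] show ?thesis by simp
  next
    case False
    then have x: "r < \<bar>x\<bar>" by simp
    have "r \<le> \<bar>x\<bar> ^ (k + 2)"
      using x assms(4) power_increasing[of 1 "k + 2" "\<bar>x\<bar>"] by simp
    then have "\<bar>x\<bar> ^ k * r \<le> \<bar>x\<bar> ^ k * \<bar>x\<bar> ^ (k + 2)"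
      by (intro mult_left_mono) auto
    also have "\<dots> = \<bar>x\<bar> ^ (2 * k + 2)"
      by (simp add: mult_2 flip: power_add)
    also have "\<dots> = x ^ (2 * k + 2)"
      by (simp add: power_even_abs)
    finally have "\<bar>x\<bar> ^ k \<le> x ^ (2 * k + 2) / r"
      using assms(4) by (simp add: field_simps)
    moreover have "\<bar>g x\<bar> \<le> \<bar>x\<bar> ^ k"
      unfolding g_def power_abs by (intro power_mono bound) auto
    ultimately show ?thesis
      using abs_triangle_ineq4[of "x ^ k" "g x"] by (simp add: power_abs)
  qed
  have "\<bar>(\<integral>x. x ^ k \<partial>M) - (\<integral>x. g x \<partial>M)\<bar> = \<bar>\<integral>x. x ^ k - g x \<partial>M\<bar>"
    using assms int_g by simp
  also have "\<dots> \<le> (\<integral>x. 2 * x ^ (2 * k + 2) / r \<partial>M)"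
  proof (rule integral_abs_bound_integral)
    show "integrable M (\<lambda>x. x ^ k - g x)"
      using assms(1) int_g by simp
    show "integrable M (\<lambda>x. 2 * x ^ (2 * k + 2) / r)"
      using assms(2) by (intro integrable_divide_zero integrable_mult_right)
  qed (use error in auto)
  also have "\<dots> = 2 * (\<integral>x. x ^ (2 * k + 2) \<partial>M) / r"
    by (simp only: integral_divide_zero integral_mult_right_zero)
  also have "\<dots> \<le> 2 * B / r"
    using assms(3,4) by (intro divide_right_mono) auto
  finally show ?thesis
    by (simp add: g_def)
qed

text \<open>The mass of a closed set is upper semicontinuous under weak limits, so the atom
  survives; bounds on higher moments carry the moments over. The offset in
  \<open>k \<le> n + 2\<close> fixes the second moment of every \<open>M n\<close>, which gives
  tightness by Markov's inequality.\<close>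

lemma weak_limit_of_moment_sequence:
  fixes M :: "nat \<Rightarrow> real measure"
  assumes dist: "\<And>n. real_distribution (M n)"
    and int: "\<And>n k. integrable (M n) (\<lambda>x. x ^ k)"
    and moment: "\<And>n k. k \<le> n + 2 \<Longrightarrow> (\<integral>x. x ^ k \<partial>M n) = m k"
    and mass: "\<And>n. \<rho> \<le> measure (M n) {c}"
  obtains N where "real_distribution N" "finite_moments N" "\<And>k. (\<integral>x. x ^ k \<partial>N) = m k"
    "\<rho> \<le> measure N {c}"
proof -
  have "tight M"
    unfolding tight_def
  proof (intro conjI allI impI dist)
    fix \<epsilon> :: real assume "0 < \<epsilon>"
    \<comment> \<open>As \<open>b \<ge> 1\<close>, the Markov bound \<open>m 2 / b\<^sup>2\<close>
      is at most \<open>\<bar>m 2\<bar> / b\<close>, which is below \<epsilon> for this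
      \<open>b\<close>.\<close>
    define b where "b = \<bar>m 2\<bar> / \<epsilon> + 1"
    have "1 \<le> b" using \<open>0 < \<epsilon>\<close> by (simp add: b_def)
    have "measure (M n) {-b<..b} > 1 - \<epsilon>" for n
    proof -
      interpret D: real_distribution "M n" by (rule dist)
      have "measure (M n) {x \<in> space (M n). b\<^sup>2 \<le> x\<^sup>2} \<le> (\<integral>x. x\<^sup>2 \<partial>M n) / b\<^sup>2"
        using \<open>1 \<le> b\<close> by (intro integral_Markov_inequality_measure[where A = "{}"] int) auto
      also have "\<dots> = m 2 / b\<^sup>2"
        by (simp add: moment)
      also have "\<dots> \<le> \<bar>m 2\<bar> / b"
        using \<open>1 \<le> b\<close> self_le_power[of b 2] by (intro frac_le) auto
      also have "\<dots> < \<epsilon>"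
        using \<open>0 < \<epsilon>\<close> \<open>1 \<le> b\<close> by (simp add: b_def field_simps)
      finally have "measure (M n) {x \<in> space (M n). b\<^sup>2 \<le> x\<^sup>2} < \<epsilon>" .
      moreover have "measure (M n) (space (M n) - {-b<..b}) \<le> measure (M n) {x \<in> space (M n). b\<^sup>2 \<le> x\<^sup>2}"
        using \<open>1 \<le> b\<close> by (intro D.finite_measure_mono) (auto simp: abs_le_square_iff[symmetric])
      ultimately show ?thesis
        using D.prob_compl[of "{-b<..b}"] by simp
    qed
    then show "\<exists>a b. a < b \<and> (\<forall>n. 1 - \<epsilon> < measure (M n) {a<..b})"
      using \<open>1 \<le> b\<close> by (intro exI[of _ "-b"] exI[of _ b]) auto
  qed
  then obtain r N where r: "strict_mono (r :: nat \<Rightarrow> nat)" and N: "real_distribution N"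
    and conv: "weak_conv_m (M \<circ> id \<circ> r) N"
    using tight_imp_convergent_subsubsequence[of M id] strict_mono_id by blast
  interpret N: real_distribution N by (rule N)
  have lim: "(\<lambda>n. \<integral>x. f x \<partial>M (r n)) \<longlonglongrightarrow> (\<integral>x. f x \<partial>N)"
    if "continuous_on UNIV f" "\<And>x. \<bar>f x\<bar> \<le> B" for f :: "real \<Rightarrow> real" and B
    using weak_conv_imp_integral_bdd_continuous_conv[OF _ N conv, of f B] that dist
    by (simp add: continuous_on_eq_continuous_at o_def)
  have int_bdd: "integrable (M n) f" if "continuous_on UNIV f" "\<And>x. \<bar>f x\<bar> \<le> B"
    for f :: "real \<Rightarrow> real" and B n
  proof -
    interpret D: real_distribution "M n" by (rule dist)
    show ?thesis
      using that borel_measurable_continuous_onI[of f]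
      by (intro D.integrable_const_bound[of _ B]) (auto intro!: AE_I2 simp: measurable_cong_sets[OF D.events_eq_borel refl])
  qed
  have int_bdd_N: "integrable N f" if "continuous_on UNIV f" "\<And>x. \<bar>f x\<bar> \<le> B"
    for f :: "real \<Rightarrow> real" and B
    using that borel_measurable_continuous_onI[of f]
    by (intro N.integrable_const_bound[of _ B]) (auto intro!: AE_I2 simp: measurable_cong_sets[OF N.events_eq_borel refl])
  have large: "eventually (\<lambda>n. (\<integral>x. x ^ k \<partial>M (r n)) = m k) sequentially" for k
    using eventually_ge_at_top[of k]
  proof eventually_elim
    case (elim n)
    with seq_suble[OF r, of n] show ?case by (intro moment) linarith
  qed

  \<comment> \<open>Test functions must be bounded, so even powers are cut at height
    \<open>i\<close> before monotone convergence is applied. This yields only an inequality, which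
    is enough for integrability and for the constant \<open>B\<close> below.\<close>
  have even: "integrable N (\<lambda>x. x ^ (2 * k)) \<and> (\<integral>x. x ^ (2 * k) \<partial>N) \<le> m (2 * k)" for k
  proof -
    define f where "f i x = min (x ^ (2 * k)) (real i)" for i x
    have nonneg: "0 \<le> x ^ (2 * k)" for x :: real by (simp add: power_mult)
    have f_cont: "continuous_on UNIV (f i)" for i
      unfolding f_def by (intro continuous_intros)
    have f_bdd: "\<bar>f i x\<bar> \<le> real i" for i x
      using nonneg[of x] by (simp add: f_def)
    have bound: "(\<integral>x. f i x \<partial>N) \<le> m (2 * k)" for i
    proof (rule tendsto_upperbound[OF lim[OF f_cont f_bdd]])
      show "eventually (\<lambda>n. (\<integral>x. f i x \<partial>M (r n)) \<le> m (2 * k)) sequentially"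
        using large[of "2 * k"]
      proof eventually_elim
        case (elim n)
        have "(\<integral>x. f i x \<partial>M (r n)) \<le> (\<integral>x. x ^ (2 * k) \<partial>M (r n))"
          by (intro integral_mono int int_bdd[OF f_cont f_bdd]) (simp add: f_def)
        with elim show ?case by simp
      qed
    qed simp
    have incs: "incseq (\<lambda>i. \<integral>x. f i x \<partial>N)"
      by (intro incseq_SucI integral_mono int_bdd_N[OF f_cont f_bdd]) (auto simp: f_def)
    obtain l where l: "(\<lambda>i. \<integral>x. f i x \<partial>N) \<longlonglongrightarrow> l"
      using incseq_convergent[OF incs] bound by metis
    have ptw: "(\<lambda>i. f i x) \<longlonglongrightarrow> x ^ (2 * k)" for x
    proof (rule tendsto_eventually)
      obtain j :: nat where "x ^ (2 * k) \<le> real j" using real_arch_simple by blast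
      then show "eventually (\<lambda>i. f i x = x ^ (2 * k)) sequentially"
        by (intro eventually_sequentiallyI[of j]) (auto simp: f_def)
    qed
    have mono: "mono (\<lambda>i. f i x)" for x
      by (auto simp: f_def mono_def)
    have "has_bochner_integral N (\<lambda>x. x ^ (2 * k)) l"
      using int_bdd_N[OF f_cont f_bdd] mono ptw l
      by (intro has_bochner_integral_monotone_convergence[of N f]) (auto intro!: AE_I2)
    moreover have "l \<le> m (2 * k)"
      by (rule LIMSEQ_le_const2[OF l]) (use bound in auto)
    ultimately show ?thesis
      by (auto simp: has_bochner_integral_iff)
  qed
  have int_N: "integrable N (\<lambda>x. x ^ k)" for k
  proof (rule Bochner_Integration.integrable_bound)
    show "integrable N (\<lambda>x. 1 + x ^ (2 * k))"
      using even[of k] by simp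
    show "(\<lambda>x. x ^ k) \<in> borel_measurable N" by simp
    have "\<bar>x ^ k\<bar> \<le> 1 + x ^ (2 * k)" for x :: real
    proof -
      have "0 \<le> (\<bar>x ^ k\<bar> - 1)\<^sup>2" "0 \<le> \<bar>x ^ k\<bar>" by simp_all
      moreover have "(\<bar>x ^ k\<bar> - 1)\<^sup>2 = x ^ (2 * k) - 2 * \<bar>x ^ k\<bar> + 1"
        by (simp add: power2_diff mult.commute[of 2 k] flip: power_mult)
      ultimately show ?thesis by linarith
    qed
    moreover have "0 \<le> x ^ (2 * k)" for x :: real by (simp add: power_mult)
    ultimately show "AE x in N. norm (x ^ k) \<le> norm (1 + x ^ (2 * k))"
      by (auto simp: add_nonneg_nonneg)
  qed
  have moments: "(\<integral>x. x ^ k \<partial>N) = m k" for k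
  proof -
    \<comment> \<open>By \<open>even\<close> this bounds the moment of order
      \<open>2 * k + 2\<close> of \<open>N\<close>, and it eventually equals that of
      \<open>M (r n)\<close>; so one truncation error serves both.\<close>
    define B where "B = m (2 * k + 2)"
    define g where "g r x = (max (- r) (min r x)) ^ k" for r x :: real
    have bound: "\<bar>(\<integral>x. x ^ k \<partial>N) - m k\<bar> \<le> 4 * B / R" if "1 \<le> R" for R
    proof -
      have g: "continuous_on UNIV (g R)" "\<And>x. \<bar>g R x\<bar> \<le> R ^ k"
        unfolding g_def using that by (auto intro!: continuous_intros power_mono simp: power_abs abs_le_iff)
      have 1: "\<bar>(\<integral>x. x ^ k \<partial>N) - (\<integral>x. g R x \<partial>N)\<bar> \<le> 2 * B / R"
        unfolding g_def using even[of "k + 1"] that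
        by (intro N.truncated_moment_error int_N) (auto simp: B_def)
      have 2: "\<bar>m k - (\<integral>x. g R x \<partial>N)\<bar> \<le> 2 * B / R"
      proof (rule tendsto_upperbound)
        show "(\<lambda>n. \<bar>m k - (\<integral>x. g R x \<partial>M (r n))\<bar>) \<longlonglongrightarrow> \<bar>m k - (\<integral>x. g R x \<partial>N)\<bar>"
          by (intro tendsto_intros lim[OF g])
        show "eventually (\<lambda>n. \<bar>m k - (\<integral>x. g R x \<partial>M (r n))\<bar> \<le> 2 * B / R) sequentially"
          using large[of k] large[of "2 * k + 2"]
        proof eventually_elim
          case (elim n)
          interpret D: real_distribution "M (r n)" by (rule dist)
          show ?case
            using D.truncated_moment_error[OF int int, of k B R] elim that
            by (simp add: g_def B_def)
        qed
      qed simp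
      from 1 2 show ?thesis by linarith
    qed
    have "(\<lambda>n. 4 * B / real (Suc n)) \<longlonglongrightarrow> 0"
      by (intro real_tendsto_divide_at_top[OF tendsto_const]
            filterlim_compose[OF filterlim_real_sequentially filterlim_Suc])
    then have "\<bar>(\<integral>x. x ^ k \<partial>N) - m k\<bar> \<le> 0"
      by (rule LIMSEQ_le_const) (use bound in auto)
    then show ?thesis by simp
  qed
  have mass_N: "\<rho> \<le> measure N {c}"
  proof -
    \<comment> \<open>Continuous tents that dominate the indicator of \<open>{c}\<close> and
      converge to it pointwise.\<close>
    define f where "f i x = max 0 (1 - real i * \<bar>x - c\<bar>)" for i x
    have f_cont: "continuous_on UNIV (f i)" for i
      unfolding f_def by (intro continuous_intros)
    have f_bdd: "\<bar>f i x\<bar> \<le> 1" for i x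
      by (simp add: f_def)
    have "\<rho> \<le> (\<integral>x. f i x \<partial>N)" for i
    proof (rule LIMSEQ_le_const[OF lim[OF f_cont f_bdd]], intro exI allI impI)
      fix n
      interpret D: real_distribution "M (r n)" by (rule dist)
      have "measure (M (r n)) {c} = (\<integral>x. indicator {c} x \<partial>M (r n))"
        by simp
      also have "\<dots> \<le> (\<integral>x. f i x \<partial>M (r n))"
        by (intro integral_mono int_bdd[OF f_cont f_bdd])
           (auto simp: f_def indicator_def intro!: D.integrable_const_bound[of _ 1] AE_I2)
      finally show "\<rho> \<le> (\<integral>x. f i x \<partial>M (r n))"
        using mass[of "r n"] by simp
    qed
    moreover have "(\<lambda>i. \<integral>x. f i x \<partial>N) \<longlonglongrightarrow> (\<integral>x. indicator {c} x \<partial>N)"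
    proof (rule integral_dominated_convergence[where w = "\<lambda>_. 1"])
      have "(\<lambda>i. f i x) \<longlonglongrightarrow> indicator {c} x" for x
      proof (rule tendsto_eventually, cases "x = c")
        case False
        then obtain j :: nat where j: "1 < real j * \<bar>x - c\<bar>"
          using reals_Archimedean3[of "\<bar>x - c\<bar>"] by auto
        show "eventually (\<lambda>i. f i x = indicator {c} x) sequentially"
        proof (rule eventually_sequentiallyI[of j])
          fix i assume "j \<le> i"
          then have "real j * \<bar>x - c\<bar> \<le> real i * \<bar>x - c\<bar>"
            by (intro mult_right_mono) auto
          with j have "1 < real i * \<bar>x - c\<bar>" by linarith
          with False show "f i x = indicator {c} x"
            by (simp add: f_def)
        qed
      qed (simp add: f_def)
      then show "AE x in N. (\<lambda>i. f i x) \<longlonglongrightarrow> indicator {c} x" by simp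
    qed (use f_bdd in \<open>auto simp: f_def[abs_def]\<close>)
    ultimately have "\<rho> \<le> (\<integral>x. indicator {c} x \<partial>N)"
      by (intro LIMSEQ_le_const) auto
    then show ?thesis by simp
  qed
  show ?thesis
    using that[OF N _ moments mass_N] int_N by (simp add: finite_moments_def)
qed

text \<open>\<open>point_measure\<close> lives on \<open>T\<close> with all subsets measurable;
  pushing it forward along the identity yields a Borel measure on the whole line.\<close>

lemma discrete_distribution:
  fixes T :: "real set"
  assumes "finite T" "\<And>t. t \<in> T \<Longrightarrow> 0 \<le> w t" "(\<Sum>t\<in>T. w t) = 1"
  obtains D where "real_distribution D"
    "\<And>f :: real \<Rightarrow> real. f \<in> borel_measurable borel \<Longrightarrow> integrable D f"
    "\<And>f :: real \<Rightarrow> real. f \<in> borel_measurable borel \<Longrightarrow> (\<integral>x. f x \<partial>D) = (\<Sum>t\<in>T. w t * f t)"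
proof -
  define P where "P = point_measure T w"
  interpret P: prob_space P
    unfolding P_def using assms by (intro prob_space_point_measure) auto
  have id: "(\<lambda>x. x) \<in> measurable P borel"
    by (simp add: P_def)
  define D where "D = distr P borel (\<lambda>x. x)"
  show ?thesis
  proof
    show "real_distribution D"
      unfolding D_def real_distribution_def real_distribution_axioms_def
      by (simp add: P.prob_space_distr[OF id])
    fix f :: "real \<Rightarrow> real" assume f: "f \<in> borel_measurable borel"
    show "integrable D f"
      unfolding D_def integrable_distr_eq[OF id f]
      unfolding P_def using assms(1) by (rule integrable_point_measure_finite)
    show "(\<integral>x. f x \<partial>D) = (\<Sum>t\<in>T. w t * f t)"
      unfolding D_def integral_distr[OF id f]
      unfolding P_def using assms by (simp add: lebesgue_integral_point_measure_finite)
  qed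
qed

section \<open>The factorization\<close>

lemma orthonormal_poly_functional_integral:
  assumes "finite_moments M" "orthonormal_polys M p"
  shows "orthonormal_poly_functional (\<lambda>f. \<integral>x. poly f x \<partial>M) p"
proof -
  interpret poly_functional "\<lambda>f. \<integral>x. poly f x \<partial>M"
    using assms(1) by (rule poly_functional_integral)
  show ?thesis
  proof
    show "degree (p n) = n" for n
      using assms(2) by (simp add: orthonormal_polys_def)
    show "(\<integral>x. poly (p m * p n) x \<partial>M) = (if m = n then 1 else 0)" for m n
      using assms(2) by (simp only: orthonormal_polys_def poly_mult)
  qed
qed

lemma integral_christoffel_measure:
  assumes "sets M = sets borel"
  shows "(\<integral>x. poly f x \<partial>christoffel_measure c M) = (\<integral>x. poly ([:-c, 1:] * ([:-c, 1:] * f)) x \<partial>M)"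
proof -
  have [measurable]: "poly f \<in> borel_measurable borel" for f :: "real poly"
    by (intro borel_measurable_continuous_onI continuous_intros)
  have [measurable_cong]: "sets M = sets borel" by fact
  have "(\<integral>x. poly f x \<partial>christoffel_measure c M) = (\<integral>x. (x - c)\<^sup>2 *\<^sub>R poly f x \<partial>M)"
    unfolding christoffel_measure_def by (rule integral_density) auto
  also have "\<dots> = (\<integral>x. poly ([:-c, 1:] * ([:-c, 1:] * f)) x \<partial>M)"
    by (intro Bochner_Integration.integral_cong) (simp_all add: power2_eq_square algebra_simps)
  finally show ?thesis .
qed

text \<open>The linear polynomial \<open>1 - \<sigma> (x - c) / b\<close> is 1 at \<open>c\<close>
  and lies in \<open>[0, 1)\<close> almost everywhere, so its powers tend to 0 there and are
  dominated by 1.\<close>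

lemma bounded_support_small_poly:
  assumes "finite_moments M" "AE x in M. 0 < \<sigma> * (x - c)" "AE x in M. \<sigma> * (x - c) \<le> B" "0 < \<epsilon>"
  shows "\<exists>q. poly q c = 1 \<and> (\<integral>x. poly (q * q) x \<partial>M) < \<epsilon>"
proof -
  define b where "b = max 1 B"
  define q where "q n = [:1 + \<sigma> * c / b, - \<sigma> / b:] ^ n" for n
  have "1 \<le> b" "B \<le> b" by (auto simp: b_def)
  have q: "poly (q n) x = (1 - \<sigma> * (x - c) / b) ^ n" for n x
    by (simp add: q_def poly_power algebra_simps diff_divide_distrib)
  have base: "AE x in M. 0 \<le> 1 - \<sigma> * (x - c) / b \<and> 1 - \<sigma> * (x - c) / b < 1"
    using assms(2,3)
  proof eventually_elim
    case (elim x)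
    with \<open>1 \<le> b\<close> \<open>B \<le> b\<close> show ?case
      by (simp add: field_simps)
  qed
  have "(\<lambda>n. \<integral>x. poly (q n * q n) x \<partial>M) \<longlonglongrightarrow> (\<integral>x. 0 \<partial>M)"
  proof (rule integral_dominated_convergence[where w = "\<lambda>_. 1"])
    show "integrable M (\<lambda>_. 1 :: real)"
      using integrable_poly[OF assms(1), of 1] by (simp add: poly_1[abs_def])
    show "poly (q n * q n) \<in> borel_measurable M" for n
      using integrable_poly[OF assms(1)] by (rule borel_measurable_integrable)
    show "AE x in M. (\<lambda>n. poly (q n * q n) x) \<longlonglongrightarrow> 0"
      using base
    proof eventually_elim
      case (elim x)
      then have "(\<lambda>n. poly (q n) x) \<longlonglongrightarrow> 0"
        unfolding q by (intro LIMSEQ_power_zero) auto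
      from tendsto_mult[OF this this] show ?case by simp
    qed
    show "AE x in M. norm (poly (q n * q n) x) \<le> 1" for n
      using base
    proof eventually_elim
      case (elim x)
      then have "0 \<le> poly (q n) x" "poly (q n) x \<le> 1"
        unfolding q by (auto intro: power_le_one)
      then show ?case by (simp add: abs_mult mult_le_one)
    qed
  qed simp
  then have "eventually (\<lambda>n. (\<integral>x. poly (q n * q n) x \<partial>M) < \<epsilon>) sequentially"
    using assms(4) by (intro order_tendstoD(2)) auto
  then obtain n where "(\<integral>x. poly (q n * q n) x \<partial>M) < \<epsilon>"
    by (auto simp: eventually_sequentially)
  moreover have "poly (q n) c = 1" by (simp add: q)
  ultimately show ?thesis by blast
qed

text \<open>This supplies the hypothesis \<open>pos\<close> of \<open>gauss_radau\<close>. The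
  integrand is nonnegative almost everywhere; were its integral 0, \<open>f\<close> would vanish
  almost everywhere, against \<open>square_eq_0_iff\<close>.\<close>

lemma one_sided_functional_pos:
  assumes "finite_moments M" "orthonormal_polys M p" "AE x in M. 0 < \<sigma> * (x - c)"
    and "f \<noteq> 0" "\<And>x. 0 \<le> poly f x"
  shows "0 < \<sigma> * (\<integral>x. poly ([:-c, 1:] * f) x \<partial>M)"
proof -
  interpret orthonormal_poly_functional "\<lambda>f. \<integral>x. poly f x \<partial>M" p
    using assms(1,2) by (rule orthonormal_poly_functional_integral)
  define h where "h = smult \<sigma> ([:-c, 1:] * f)"
  have h: "poly h x = \<sigma> * (x - c) * poly f x" for x
    by (simp add: h_def algebra_simps)
  have nonneg: "AE x in M. 0 \<le> poly h x"
    using assms(3) by eventually_elim (simp add: h assms(5) less_imp_le)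
  have "(\<integral>x. poly h x \<partial>M) \<noteq> 0"
  proof
    assume "(\<integral>x. poly h x \<partial>M) = 0"
    then have "AE x in M. poly h x = 0"
      using nonneg integral_nonneg_eq_0_iff_AE[OF integrable_poly[OF assms(1)]] by blast
    then have "AE x in M. poly (f * f) x = 0"
      using assms(3) by eventually_elim (auto simp: h)
    then have "(\<integral>x. poly (f * f) x \<partial>M) = 0"
      by (rule integral_eq_zero_AE)
    with square_eq_0_iff[of f] assms(4) show False by simp
  qed
  with integral_nonneg_AE[OF nonneg] have "0 < (\<integral>x. poly h x \<partial>M)" by simp
  also have "(\<integral>x. poly h x \<partial>M) = \<sigma> * (\<integral>x. poly ([:-c, 1:] * f) x \<partial>M)"
    unfolding h_def by (rule smult)
  finally show ?thesis .
qed

lemma determinate_small_poly: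
  assumes sets: "sets M = sets borel" and fin: "finite_moments M" and det: "moment_determinate M"
    and orth: "orthonormal_polys M p" and sign: "AE x in M. 0 < \<sigma> * (x - c)"
    and nz: "\<And>n. n \<ge> 1 \<Longrightarrow> poly (p n) c \<noteq> 0" and "0 < \<epsilon>"
  shows "\<exists>q. poly q c = 1 \<and> (\<integral>x. poly (q * q) x \<partial>M) < \<epsilon>"
proof (rule ccontr)
  assume no_small: "\<nexists>q. poly q c = 1 \<and> (\<integral>x. poly (q * q) x \<partial>M) < \<epsilon>"
  define L where "L f = (\<integral>x. poly f x \<partial>M)" for f
  interpret orthonormal_poly_functional L p
    using orthonormal_poly_functional_integral[OF fin orth] by (simp add: L_def[abs_def])
  have L_power: "L (monom 1 k) = (\<integral>x. x ^ k \<partial>M)" for k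
    by (simp add: L_def poly_monom)
  \<comment> \<open>\<open>m0\<close> is the total mass; dividing by it turns the quadrature rules
    into probability distributions.\<close>
  define m0 where "m0 = L 1"
  have "0 < m0"
    using square_nonneg[of 1] square_eq_0_iff[of 1] by (simp add: m0_def)
  have "\<exists>D. real_distribution D \<and> (\<forall>k. integrable D (\<lambda>x. x ^ k)) \<and>
      (\<forall>k\<le>n + 2. (\<integral>x. x ^ k \<partial>D) = L (monom 1 k) / m0) \<and> \<epsilon> / m0 \<le> measure D {c}" for n
  proof -
    \<comment> \<open>The index \<open>n + 2\<close> gives exactness up to degree
      \<open>2 * (n + 2)\<close>, which covers the moments of order at most \<open>n + 2\<close>,
      and it is at least 1, as \<open>nz\<close> demands.\<close>
    have nz': "poly (p (n + 2)) c \<noteq> 0"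
      by (rule nz) simp
    have pos: "0 < \<sigma> * L ([:-c, 1:] * f)" if "f \<noteq> 0" "\<And>x. 0 \<le> poly f x" for f
      unfolding L_def using one_sided_functional_pos[OF fin orth sign] that by blast
    obtain T w q where T: "finite T" "c \<in> T" and w: "\<And>t. t \<in> T \<Longrightarrow> 0 \<le> w t"
      and q: "poly q c = 1" "w c = L (q * q)"
      and exact: "\<And>f. degree f \<le> 2 * (n + 2) \<Longrightarrow> L f = (\<Sum>t\<in>T. w t * poly f t)"
      by (rule gauss_radau[OF nz' pos]) blast+
    have "(\<Sum>t\<in>T. w t) = m0"
      using exact[of 1] by (simp add: m0_def)
    then have total: "(\<Sum>t\<in>T. w t / m0) = 1"
      using \<open>0 < m0\<close> by (simp flip: sum_divide_distrib)
    have "0 \<le> w t / m0" if "t \<in> T" for t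
      using w[OF that] \<open>0 < m0\<close> by simp
    note weights = T(1) this total
    obtain D where D: "real_distribution D"
      "\<And>f :: real \<Rightarrow> real. f \<in> borel_measurable borel \<Longrightarrow> integrable D f"
      "\<And>f :: real \<Rightarrow> real. f \<in> borel_measurable borel \<Longrightarrow> (\<integral>x. f x \<partial>D) = (\<Sum>t\<in>T. w t / m0 * f t)"
      by (rule discrete_distribution[OF weights]) blast+
    interpret D: real_distribution D by (rule D)
    have "integrable D (\<lambda>x. x ^ k)" for k
      by (rule D(2)) simp
    moreover have "(\<integral>x. x ^ k \<partial>D) = L (monom 1 k) / m0" if "k \<le> n + 2" for k
    proof -
      have "degree (monom (1::real) k) \<le> 2 * (n + 2)"
        using that by (simp add: degree_monom_eq)
      then show ?thesis
        by (simp add: exact poly_monom D(3) sum_divide_distrib)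
    qed
    moreover have "\<epsilon> / m0 \<le> measure D {c}"
    proof -
      have "measure D {c} = (\<integral>x. indicator {c} x \<partial>D)" by simp
      also have "\<dots> = (\<Sum>t\<in>T. w t / m0 * indicator {c} t)"
        by (rule D(3)) simp
      also have "\<dots> = w c / m0"
        by (subst sum.remove[OF T]) (auto intro!: sum.neutral)
      \<comment> \<open>The weight \<open>w c\<close> is \<open>L (q * q)\<close> with
        \<open>poly q c = 1\<close>, so \<open>no_small\<close> bounds it below by
        \<epsilon>.\<close>
      finally show ?thesis
        using no_small q \<open>0 < m0\<close> by (auto simp: L_def not_less divide_right_mono)
    qed
    ultimately show ?thesis using D(1) by blast
  qed
  then obtain D where D: "\<And>n. real_distribution (D n)" "\<And>n k. integrable (D n) (\<lambda>x. x ^ k)"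
    "\<And>n k. k \<le> n + 2 \<Longrightarrow> (\<integral>x. x ^ k \<partial>D n) = L (monom 1 k) / m0" "\<And>n. \<epsilon> / m0 \<le> measure (D n) {c}"
    by metis
  obtain N where N: "real_distribution N" "finite_moments N"
    "\<And>k. (\<integral>x. x ^ k \<partial>N) = L (monom 1 k) / m0" "\<epsilon> / m0 \<le> measure N {c}"
    by (rule weak_limit_of_moment_sequence[OF D]) blast+
  interpret N: real_distribution N by (rule N)
  define N' where "N' = density N (\<lambda>_. ennreal m0)"
  have "finite_moments N'"
    using N(2) \<open>0 < m0\<close> unfolding N'_def finite_moments_def
    by (subst integrable_density) auto
  moreover have "(\<integral>x. x ^ k \<partial>N') = (\<integral>x. x ^ k \<partial>M)" for k
    unfolding N'_def using \<open>0 < m0\<close> by (subst integral_density) (auto simp: N(3) L_power)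
  moreover have "sets N' = sets borel" by (simp add: N'_def)
  ultimately have "N' = M"
    using det by (simp add: moment_determinate_def)
  \<comment> \<open>\<open>M\<close> has no mass at \<open>c\<close> since
    \<open>\<sigma> * (x - c)\<close> is positive almost everywhere, whereas \<open>N'\<close> has
    an atom there.\<close>
  have "AE x in M. x \<noteq> c"
    using sign by eventually_elim auto
  then have "emeasure M {c} = 0"
    using sets by (subst (asm) AE_iff_measurable[where N = "{c}"]) (auto simp: sets_eq_imp_space_eq[OF sets])
  then have "ennreal m0 * emeasure N {c} = 0"
    by (simp add: N'_def emeasure_density_const flip: \<open>N' = M\<close>)
  then have "measure N {c} = 0"
    using \<open>0 < m0\<close> by (simp add: measure_def)
  moreover have "0 < \<epsilon> / m0"
    using \<open>0 < m0\<close> \<open>0 < \<epsilon>\<close> by simp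
  ultimately show False
    using N(4) by simp
qed

theorem proposition4:
  fixes \<mu> :: "real measure" and E :: "real set" and c :: real
    and p p2 :: "nat \<Rightarrow> real poly" and J J2 :: smat
  assumes "sets \<mu> = sets borel"
    and "finite_moments \<mu>"
    and "infinite (measure_support \<mu>)"
    and "is_interval E" and "measure_support \<mu> \<subseteq> E"
    and "c \<notin> E"
    and "orthonormal_polys \<mu> p"
    and "jacobi_matrix_of p J"
    and "\<And>n. n \<ge> 1 \<Longrightarrow> poly (p n) c \<noteq> 0"
    and "orthonormal_polys (christoffel_measure c \<mu>) p2"
    and "jacobi_matrix_of p2 J2"
  shows "\<exists>Q R. upper_triangular_smat R \<and>
           has_smat_prod (smat_transpose Q) Q smat_id \<and>
           (bounded E \<or> moment_determinate \<mu> \<longrightarrow> orthogonal_smat Q) \<and>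
           has_smat_prod Q R (smat_shift J c) \<and>
           has_smat_prod R Q (smat_shift J2 c)"
proof -
  define L where "L f = (\<integral>x. poly f x \<partial>\<mu>)" for f
  interpret L: orthonormal_poly_functional L p
    using orthonormal_poly_functional_integral[OF assms(2,7)] by (simp add: L_def[abs_def])
  interpret L: christoffel_functional L p c p2
  proof
    show "L ([:-c, 1:] * ([:-c, 1:] * (f + g))) = L ([:-c, 1:] * ([:-c, 1:] * f)) + L ([:-c, 1:] * ([:-c, 1:] * g))" for f g
      by (simp only: distrib_left L.add)
    show "L ([:-c, 1:] * ([:-c, 1:] * smult a f)) = a * L ([:-c, 1:] * ([:-c, 1:] * f))" for a f
      by (simp only: mult_smult_right L.smult)
    show "degree (p2 n) = n" for n
      using assms(10) by (simp add: orthonormal_polys_def)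
    show "L ([:-c, 1:] * ([:-c, 1:] * (p2 m * p2 n))) = (if m = n then 1 else 0)" for m n
      using assms(10) integral_christoffel_measure[OF assms(1), of c "p2 m * p2 n"]
      by (simp only: L_def orthonormal_polys_def poly_mult)
  qed
  have supp: "AE x in \<mu>. x \<in> E"
    using AE_measure_support[OF assms(1)] assms(5) by (auto elim: eventually_mono)
  \<comment> \<open>An interval that omits \<open>c\<close> lies on one side of it; \<sigma> records
    which.\<close>
  have "(\<forall>x\<in>E. c < x) \<or> (\<forall>x\<in>E. x < c)"
    using assms(4,6) unfolding is_interval_1 by (metis linorder_less_linear less_imp_le)
  then obtain \<sigma> where \<sigma>: "\<sigma> \<in> {1, -1}" "\<forall>x\<in>E. 0 < \<sigma> * (x - c)"
    by (metis (no_types, lifting) diff_gt_0_iff_gt insertCI mult_1 mult_minus1 minus_diff_eq)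
  have sign: "AE x in \<mu>. 0 < \<sigma> * (x - c)"
    using supp by eventually_elim (use \<sigma> in auto)
  have "orthogonal_smat L.Q" if "bounded E \<or> moment_determinate \<mu>"
  proof (rule L.orthogonal_Q)
    fix \<epsilon> :: real assume "0 < \<epsilon>"
    from that show "\<exists>q. poly q c = 1 \<and> L (q * q) < \<epsilon>"
    proof
      assume "bounded E"
      then obtain B where B: "\<And>x. x \<in> E \<Longrightarrow> \<bar>x\<bar> \<le> B"
        by (auto simp: bounded_iff)
      have "AE x in \<mu>. \<sigma> * (x - c) \<le> B + \<bar>c\<bar>"
        using supp
      proof eventually_elim
        case (elim x)
        with B[of x] \<sigma>(1) show ?case by auto
      qed
      with \<open>0 < \<epsilon>\<close> sign assms(2) show ?thesis
        unfolding L_def by (intro bounded_support_small_poly)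
    next
      assume "moment_determinate \<mu>"
      with \<open>0 < \<epsilon>\<close> sign assms(1,2,7,9) show ?thesis
        unfolding L_def by (intro determinate_small_poly)
    qed
  qed
  with L.upper_triangular_R L.Qt_Q L.Q_R[OF assms(8)] L.R_Q[OF assms(11)]
  show ?thesis by blast
qed

end
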